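(* Let $t_0>0$, let $\lambda,\gamma>0$, let $g:\mathbb{R}^n\to\mathbb{R}$ be a Fréchet differentiable function (possibly nonconvex) whose gradient $\nabla g$ is Lipschitz continuous on $\mathbb{R}^n$, and assume that $g$ is bounded from below. For $u_0,v_0\in\mathbb{R}^n$, let $x:[t_0,+\infty)\to\mathbb{R}^n$ be the unique strong global solution of the dynamical system $$\frac{\lambda}{t^2}\ddot{x}(t)+\frac{\gamma}{t}\dot{x}(t)+\nabla g(x(t))=0,\qquad x(t_0)=u_0,\ \dot{x}(t_0)=v_0.$$ Suppose that $x$ is bounded, let $\bar x\in\operatorname{crit}(g)$ be such that $\lim_{t\to+\infty}x(t)=\bar x$, and suppose that $g$ fulfills the Łojasiewicz property at $\bar x$ with Łojasiewicz exponent $\theta\in\left[\frac12,1\right)$. Then: - if $\theta=\frac12$, there exist $a_1,a_2>0$ and $t'>0$ such that $\|x(t)-\bar x\|\le a_1e^{-a_2t^2}$ for every $t\in[t',+\infty)$; - if $\theta\in\left(\frac12,1\right)$, there exist $a_3,a_4>0$ and $t'>0$ such that $\|x(t)-\bar x\|\le(a_3t^2+a_4)^{-\frac{1-\theta}{2\theta-1}}$ for every $t\in[t',+\infty)$.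
   Context: $\mathbb{R}^n$ carries the Euclidean norm. $\operatorname{crit}(g)=\{z\in\mathbb{R}^n:\nabla g(z)=0\}$. Strong global solution: a function $x:[t_0,+\infty)\to\mathbb{R}^n$ such that (i) $x,\dot x,\ddot x:[t_0,+\infty)\to\mathbb{R}^n$ are locally absolutely continuous, i.e. absolutely continuous on each interval $[t_0,b]$ with $t_0<b<+\infty$; (ii) $\frac{\lambda}{t^2}\ddot{x}(t)+\frac{\gamma}{t}\dot{x}(t)+\nabla g(x(t))=0$ for almost every $t\ge t_0$; (iii) $x(t_0)=u_0$ and $\dot x(t_0)=v_0$. Under the stated assumptions such a solution exists and is unique. A differentiable function $f:\mathbb{R}^m\to\mathbb{R}$ fulfills the Łojasiewicz property at a critical point $\bar z\in\operatorname{crit}(f)$ with Łojasiewicz exponent $\theta\in(0,1)$ if there exist $K,\epsilon>0$ such that $|f(z)-f(\bar z)|^\theta\le K\|\nabla f(z)\|$ for every $z$ with $\|z-\bar z\|<\epsilon$. *)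

theory Defs
  imports "HOL-Analysis.Analysis"
begin

text \<open>The gradient is only meaningful where the function is Frechet differentiable;
  differentiability is always assumed separately.\<close>

definition gradient :: "('a::euclidean_space \<Rightarrow> real) \<Rightarrow> 'a \<Rightarrow> 'a" where
  "gradient f z = (THE D. GDERIV f z :> D)"

lemma gradient_eqI:
  assumes "GDERIV f z :> D"
  shows "gradient f z = D"
proof -
  have "E = D" if "GDERIV f z :> E" for E
  proof -
    have "(\<lambda>h. inner h E) = (\<lambda>h. inner h D)"
      using that assms unfolding gderiv_def by (rule has_derivative_unique)
    then have "\<forall>h. inner h E = inner h D" by metis
    then show ?thesis by (simp add: vector_eq_ldot)
  qed
  with assms show ?thesis unfolding gradient_def by blast
qed

lemma gderiv_gradient:
  assumes "f differentiable (at z)"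
  shows "GDERIV f z :> gradient f z"
proof -
  obtain f' where f': "(f has_derivative f') (at z)"
    using assms unfolding differentiable_def by blast
  then interpret f': linear f' by (rule has_derivative_linear)
  have "f' h = inner h (adjoint f' 1)" for h
    using adjoint_works[OF f'.linear_axioms, of h 1] by simp
  then have "f' = (\<lambda>h. inner h (adjoint f' 1))" by blast
  with f' have "GDERIV f z :> adjoint f' 1" unfolding gderiv_def by metis
  with gradient_eqI show ?thesis by metis
qed

definition crit :: "('a::euclidean_space \<Rightarrow> real) \<Rightarrow> 'a set" where
  "crit f = {z. gradient f z = 0}"

definition lojasiewicz_property ::
    "('a::euclidean_space \<Rightarrow> real) \<Rightarrow> 'a \<Rightarrow> real \<Rightarrow> bool" where
  "lojasiewicz_property f zbar \<theta> \<longleftrightarrow>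
     f differentiable_on UNIV \<and> zbar \<in> crit f \<and> 0 < \<theta> \<and> \<theta> < 1 \<and>
     (\<exists>K>0. \<exists>\<epsilon>>0. \<forall>z. norm (z - zbar) < \<epsilon> \<longrightarrow>
        \<bar>f z - f zbar\<bar> powr \<theta> \<le> K * norm (gradient f z))"

text \<open>Absolute continuity of a function on a compact interval; a pair \<open>(c, d)\<close> in \<open>D\<close>
  stands for the open interval from \<open>c\<close> to \<open>d\<close>. (The library constant
  \<open>absolutely_continuous\<close> concerns measures.)\<close>

definition abs_continuous_on_interval ::
    "real \<Rightarrow> real \<Rightarrow> (real \<Rightarrow> 'a::real_normed_vector) \<Rightarrow> bool" where
  "abs_continuous_on_interval a b f \<longleftrightarrow>
     (\<forall>\<epsilon>>0. \<exists>\<delta>>0. \<forall>D :: (real \<times> real) set.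
        finite D \<and> (\<forall>(c, d)\<in>D. a \<le> c \<and> c < d \<and> d \<le> b) \<and>
        disjoint_family_on (\<lambda>(c, d). {c<..<d}) D \<and>
        (\<Sum>(c, d)\<in>D. d - c) < \<delta> \<longrightarrow>
        (\<Sum>(c, d)\<in>D. norm (f d - f c)) < \<epsilon>)"

definition locally_abs_continuous_from ::
    "real \<Rightarrow> (real \<Rightarrow> 'a::real_normed_vector) \<Rightarrow> bool" where
  "locally_abs_continuous_from t0 f \<longleftrightarrow> (\<forall>b>t0. abs_continuous_on_interval t0 b f)"

text \<open>A trajectory on the half-line from \<open>t0\<close> is a total function of which only the values
  at \<open>t \<ge> t0\<close> matter: derivatives are taken within \<open>{t0..}\<close>, hence are
  right derivatives at \<open>t0\<close>. They are unique, so \<open>x'\<close> and \<open>x''\<close> are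
  determined by \<open>x\<close> on \<open>{t0..}\<close>.\<close>

definition strong_global_solution ::
    "real \<Rightarrow> real \<Rightarrow> ('a::euclidean_space \<Rightarrow> real) \<Rightarrow> real \<Rightarrow> 'a \<Rightarrow> 'a \<Rightarrow> (real \<Rightarrow> 'a) \<Rightarrow> bool" where
  "strong_global_solution lam \<gamma> g t0 u0 v0 x \<longleftrightarrow>
     (\<exists>x' x''.
        (\<forall>t\<ge>t0. (x has_vector_derivative x' t) (at t within {t0..})) \<and>
        (\<forall>t\<ge>t0. (x' has_vector_derivative x'' t) (at t within {t0..})) \<and>
        locally_abs_continuous_from t0 x \<and>
        locally_abs_continuous_from t0 x' \<and>
        locally_abs_continuous_from t0 x'' \<and>
        (AE t in lebesgue. t \<ge> t0 \<longrightarrow>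
           (lam / t\<^sup>2) *\<^sub>R x'' t + (\<gamma> / t) *\<^sub>R x' t + gradient g (x t) = 0) \<and>
        x t0 = u0 \<and> x' t0 = v0)"

end

theory Submission
  imports Defs
begin

text \<open>
  With \<open>v = x' / t\<close> the equation becomes
  \<open>v' = - (t / \<lambda>) ((\<gamma> + \<lambda> / t\<^sup>2) v + \<nabla> g(x))\<close>: in the new time \<open>t\<^sup>2 / 2\<close> this is a heavy ball
  with friction bounded away from zero, which is why \<open>t\<^sup>2\<close> appears in the rates. For large \<open>A\<close> the
  function \<open>W = A (g(x) + \<lambda>/2 |v|\<^sup>2) + g(x + v) - (A + 1) g(xbar)\<close> satisfies
  \<open>W' \<le> - \<kappa> t d\<^sup>2\<close> with \<open>d\<^sup>2 = |\<nabla> g(x)|\<^sup>2 + |v|\<^sup>2\<close>, and since \<open>\<theta> \<ge> 1/2\<close> the Lojasiewicz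
  inequality yields \<open>W\<^sup>\<theta> \<le> C d\<close>. Hence \<open>W' \<le> - k t W powr (2\<theta>)\<close>, which gives the decay of \<open>W\<close>,
  and \<open>|x'| = t |v|\<close> is at most a multiple of \<open>- (W powr (1 - \<theta>))'\<close>, so that
  \<open>|x - xbar|\<close> is at most a multiple of \<open>W powr (1 - \<theta>)\<close>.
\<close>

section \<open>Differential inequalities in the time \<open>t\<^sup>2\<close>\<close>

text \<open>The integrating factor \<open>exp (k / 2 * s\<^sup>2)\<close> makes the product
  nonincreasing. The sign of \<open>w\<close> is left free because the lemma is also applied to a
  function that may change sign, namely \<open>|v|\<^sup>2 - \<epsilon>\<close>.\<close>

lemma gaussian_decay:
  fixes w w' :: "real \<Rightarrow> real"
  assumes deriv: "\<And>s. s \<ge> t1 \<Longrightarrow> (w has_real_derivative w' s) (at s)"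
    and le: "\<And>s. s \<ge> t1 \<Longrightarrow> w' s \<le> - k * s * w s"
    and "t1 \<le> t"
  shows "w t \<le> w t1 * exp (k / 2 * t1\<^sup>2) * exp (- (k / 2) * t\<^sup>2)"
proof -
  let ?f = "\<lambda>s. w s * exp (k / 2 * s\<^sup>2)"
  have "?f t \<le> ?f t1"
  proof (rule DERIV_nonpos_imp_nonincreasing[OF \<open>t1 \<le> t\<close>])
    fix s assume "t1 \<le> s"
    have "(?f has_real_derivative (w' s + k * s * w s) * exp (k / 2 * s\<^sup>2)) (at s)"
      by (auto intro!: derivative_eq_intros deriv[OF \<open>t1 \<le> s\<close>] simp: algebra_simps)
    moreover have "(w' s + k * s * w s) * exp (k / 2 * s\<^sup>2) \<le> 0"
      using le[OF \<open>t1 \<le> s\<close>] by (simp add: mult_le_0_iff)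
    ultimately show "\<exists>y. (?f has_real_derivative y) (at s) \<and> y \<le> 0" by blast
  qed
  then show ?thesis
    by (simp add: exp_minus field_simps)
qed

text \<open>Bernoulli substitution: the derivative of \<open>w powr - r\<close> is
  \<open>- r * w powr (- r - 1) * w'\<close>, and the hypothesis on \<open>w'\<close> cancels the
  power, leaving at least \<open>r * k * s\<close>. Integration gives quadratic growth.\<close>

lemma powr_decay:
  fixes w w' :: "real \<Rightarrow> real"
  assumes deriv: "\<And>s. s \<ge> t1 \<Longrightarrow> (w has_real_derivative w' s) (at s)"
    and pos: "\<And>s. s \<ge> t1 \<Longrightarrow> w s > 0"
    and le: "\<And>s. s \<ge> t1 \<Longrightarrow> w' s \<le> - k * s * w s powr (1 + r)"
    and "r > 0" "t1 \<le> t"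
  shows "w t1 powr - r + r * k / 2 * (t\<^sup>2 - t1\<^sup>2) \<le> w t powr - r"
proof -
  let ?f = "\<lambda>s. w s powr - r - r * k / 2 * s\<^sup>2"
  have "?f t1 \<le> ?f t"
  proof (rule DERIV_nonneg_imp_nondecreasing[OF \<open>t1 \<le> t\<close>])
    fix s assume s: "t1 \<le> s"
    have "(?f has_real_derivative - r * w s powr (- r - 1) * w' s - r * k * s) (at s)"
      using pos[OF s]
      by (auto intro!: derivative_eq_intros DERIV_fun_powr deriv[OF s])
    moreover have "w s powr (- r - 1) * w' s \<le> w s powr (- r - 1) * (- k * s * w s powr (1 + r))"
      using le[OF s] by (intro mult_left_mono) auto
    then have "w s powr (- r - 1) * w' s \<le> - k * s * (w s powr (- r - 1) * w s powr (1 + r))"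
      by (simp add: mult_ac)
    then have "w s powr (- r - 1) * w' s \<le> - k * s"
      using pos[OF s] by (simp flip: powr_add)
    then have "r * (w s powr (- r - 1) * w' s) \<le> r * (- k * s)"
      using \<open>r > 0\<close> by (intro mult_left_mono) auto
    then have "0 \<le> - r * w s powr (- r - 1) * w' s - r * k * s"
      by (simp add: mult.assoc)
    ultimately show "\<exists>y. (?f has_real_derivative y) (at s) \<and> 0 \<le> y" by blast
  qed
  then show ?thesis by (simp add: right_diff_distrib)
qed

section \<open>Abstract convergence rates from a Lyapunov function\<close>

text \<open>This part of the argument is independent of the differential equation. It rests on a
  dichotomy: either \<open>W\<close> reaches zero and the trajectory stops, or \<open>W\<close>
  stays positive and negative powers of it are available.\<close>

lemma lojasiewicz_rate:
  fixes x x' :: "real \<Rightarrow> 'a::real_normed_vector" and W w d :: "real \<Rightarrow> real"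
  assumes "t1 > 0" "\<kappa> > 0" "C > 0" and \<theta>: "1/2 \<le> \<theta>" "\<theta> < 1"
    and W_deriv: "\<And>t. t \<ge> t1 \<Longrightarrow> (W has_real_derivative w t) (at t)"
    and x_deriv: "\<And>t. t \<ge> t1 \<Longrightarrow> (x has_vector_derivative x' t) (at t)"
    and w_le: "\<And>t. t \<ge> t1 \<Longrightarrow> w t \<le> - \<kappa> * t * (d t)\<^sup>2"
    and x'_le: "\<And>t. t \<ge> t1 \<Longrightarrow> norm (x' t) \<le> t * d t"
    and abs_W_le: "\<And>t. t \<ge> t1 \<Longrightarrow> \<bar>W t\<bar> powr \<theta> \<le> C * d t"
    and W_lim: "(W \<longlongrightarrow> 0) at_top" and x_lim: "(x \<longlongrightarrow> xbar) at_top"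
  shows "\<theta> = 1/2 \<Longrightarrow> \<exists>a1>0. \<exists>a2>0. \<exists>t'\<ge>t1. \<forall>t\<ge>t'. norm (x t - xbar) \<le> a1 * exp (- a2 * t\<^sup>2)"
    and "1/2 < \<theta> \<Longrightarrow> \<exists>a3>0. \<exists>a4>0. \<exists>t'\<ge>t1. \<forall>t\<ge>t'. norm (x t - xbar)
           \<le> (a3 * t\<^sup>2 + a4) powr (- ((1 - \<theta>) / (2 * \<theta> - 1)))"
proof -
  have w_nonpos: "w t \<le> 0" if "t \<ge> t1" for t
  proof -
    have "0 \<le> \<kappa> * t * (d t)\<^sup>2" using \<open>\<kappa> > 0\<close> \<open>t1 > 0\<close> that by simp
    then show ?thesis using w_le[OF that] by simp
  qed
  have W_mono: "W b \<le> W a" if "t1 \<le> a" "a \<le> b" for a b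
    by (rule DERIV_nonpos_imp_nonincreasing[OF \<open>a \<le> b\<close>])
      (use W_deriv w_nonpos that in \<open>meson order_trans\<close>)
  have W_nonneg: "0 \<le> W t" if "t1 \<le> t" for t
    by (rule tendsto_upperbound[OF W_lim])
      (use W_mono that in \<open>auto simp: eventually_at_top_linorder\<close>)
  have W_le: "W t powr \<theta> \<le> C * d t" if "t \<ge> t1" for t
    using abs_W_le[OF that] W_nonneg[OF that] by simp
  have x_cont: "isCont x t" if "t \<ge> t1" for t
    using x_deriv[OF that] by (rule has_vector_derivative_continuous)
  \<comment> \<open>The degenerate case: once zero, \<open>W\<close> stays zero, so its derivative
    vanishes, and the dissipation inequality forces \<open>d = 0\<close> and then
    \<open>x' = 0\<close>.\<close>
  have stationary: "\<exists>t'\<ge>t1. \<forall>t\<ge>t'. x t = xbar" if "t2 \<ge> t1" "W t2 = 0" for t2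
  proof -
    have W0: "W t = 0" if "t \<ge> t2" for t
      using W_mono[of t2 t] W_nonneg[of t] that \<open>t2 \<ge> t1\<close> \<open>W t2 = 0\<close> by auto
    have x'0: "x' t = 0" if "t > t2" for t
    proof -
      have "(W has_real_derivative 0) (at t)"
        by (rule has_field_derivative_transform_within_open[of "\<lambda>_. 0" _ _ "{t2<..}"])
          (use that W0 in auto)
      moreover have t: "t1 \<le> t" "0 < t" using that \<open>t2 \<ge> t1\<close> \<open>t1 > 0\<close> by auto
      ultimately have "w t = 0" using W_deriv[of t] DERIV_unique by blast
      then have "\<kappa> * t * (d t)\<^sup>2 \<le> 0" using w_le[OF t(1)] by simp
      then have "d t = 0" using \<open>\<kappa> > 0\<close> t by (simp add: mult_le_0_iff)
      then show ?thesis using x'_le[OF t(1)] by simp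
    qed
    \<comment> \<open>\<open>x' = 0\<close> is known only strictly after \<open>t2\<close>, where
      \<open>W\<close> vanishes on a two-sided neighbourhood; starting at \<open>t2 + 1\<close>
      stays clear of the endpoint.\<close>
    have const: "x a = x b" if "t2 + 1 \<le> a" "a \<le> b" for a b
    proof (cases "a = b")
      case False
      have "norm (x b - x a) \<le> 0 - 0"
      proof (rule differentiable_bound_general[of a b x "\<lambda>_. 0" x' "\<lambda>_. 0"])
        show "continuous_on {a..b} x"
          by (rule continuous_at_imp_continuous_on)
            (use x_cont that \<open>t2 \<ge> t1\<close> in auto)
        show "(x has_vector_derivative x' s) (at s)" if "a < s" for s
          using that \<open>t2 + 1 \<le> a\<close> \<open>t2 \<ge> t1\<close> by (intro x_deriv) auto
      qed (use False that x'0 in auto)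
      then show ?thesis by simp
    qed simp
    have "x a = xbar" if "t2 + 1 \<le> a" for a
    proof -
      have "eventually (\<lambda>b. x b = x a) at_top"
        unfolding eventually_at_top_linorder using const[OF that] by (intro exI[of _ a]) simp
      then have "(x \<longlongrightarrow> x a) at_top" by (rule tendsto_eventually)
      then show ?thesis using tendsto_unique[OF _ x_lim] by force
    qed
    then show ?thesis using \<open>t2 \<ge> t1\<close> by (intro exI[of _ "t2 + 1"]) auto
  qed
  \<comment> \<open>Chosen so that \<open>Q * (1 - \<theta>) * \<kappa> = C\<close>, which makes the
    speed bound \<open>s * d s\<close> at most the derivative of
    \<open>- Q * W s powr (1 - \<theta>)\<close>.\<close>
  define Q where "Q = C / ((1 - \<theta>) * \<kappa>)"
  have "Q > 0" unfolding Q_def using assms by simp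
  have d_pos: "d t > 0" if "t \<ge> t1" "W t > 0" for t
  proof -
    have "0 < C * d t" using W_le[OF that(1)] that(2) by (smt (verit) powr_gt_zero)
    then show ?thesis using \<open>C > 0\<close> by (simp add: zero_less_mult_iff)
  qed
  have length_bound: "norm (x t - xbar) \<le> Q * W t powr (1 - \<theta>)"
    if Wpos: "\<And>s. s \<ge> t1 \<Longrightarrow> W s > 0" and "t \<ge> t1" for t
  proof -
    have "norm (x b - x t) \<le> Q * W t powr (1 - \<theta>)" if "b > t" for b
    proof -
      let ?phi = "\<lambda>s. - Q * W s powr (1 - \<theta>)"
      let ?phi' = "\<lambda>s. - Q * ((1 - \<theta>) * W s powr (- \<theta>) * w s)"
      have phi_deriv: "(?phi has_real_derivative ?phi' s) (at s)" if "s \<ge> t" for s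
        using DERIV_fun_powr[OF W_deriv[of s] Wpos[of s], of "1 - \<theta>"] that \<open>t \<ge> t1\<close>
        by (intro DERIV_cmult) auto
      have "norm (x b - x t) \<le> ?phi b - ?phi t"
      proof (rule differentiable_bound_general[OF \<open>b > t\<close>])
        show "continuous_on {t..b} x"
          by (rule continuous_at_imp_continuous_on)
            (use x_cont that \<open>t \<ge> t1\<close> in auto)
        show "continuous_on {t..b} ?phi"
          by (rule continuous_at_imp_continuous_on)
            (use phi_deriv in \<open>auto intro!: DERIV_isCont\<close>)
        fix s assume s: "t < s" "s < b"
        then have s1: "t1 \<le> s" "0 < s" using \<open>t \<ge> t1\<close> \<open>t1 > 0\<close> by auto
        show "(x has_vector_derivative x' s) (at s)" using x_deriv s1 by blast
        show "(?phi has_vector_derivative ?phi' s) (at s)"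
          using phi_deriv[of s] s by (simp add: has_real_derivative_iff_has_vector_derivative)
        \<comment> \<open>The Lojasiewicz bound divided by \<open>W s powr \<theta>\<close>:
          multiplying \<open>s * d s\<close> by a factor at least 1 turns it into the dissipation
          \<open>s * (d s)\<^sup>2\<close>, which is controlled by \<open>- w s\<close>.\<close>
        have "1 = W s powr (- \<theta>) * W s powr \<theta>"
          using Wpos[OF s1(1)] by (simp flip: powr_add)
        also have "\<dots> \<le> W s powr (- \<theta>) * (C * d s)"
          using W_le[OF s1(1)] by (intro mult_left_mono) auto
        finally have *: "1 \<le> W s powr (- \<theta>) * (C * d s)" .
        have "s * d s * 1 \<le> s * d s * (W s powr (- \<theta>) * (C * d s))"
          using d_pos[OF s1(1) Wpos[OF s1(1)]] s1 by (intro mult_left_mono *) auto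
        also have "\<dots> = Q * ((1 - \<theta>) * W s powr (- \<theta>) * (\<kappa> * s * (d s)\<^sup>2))"
          unfolding Q_def using \<theta> \<open>\<kappa> > 0\<close> by (simp add: power2_eq_square field_simps)
        also have "\<dots> \<le> Q * ((1 - \<theta>) * W s powr (- \<theta>) * (- w s))"
          using w_le[OF s1(1)] \<open>Q > 0\<close> \<theta> by (intro mult_left_mono) auto
        finally show "norm (x' s) \<le> ?phi' s" using x'_le[OF s1(1)] by simp
      qed
      also have "\<dots> \<le> Q * W t powr (1 - \<theta>)" using \<open>Q > 0\<close> by simp
      finally show ?thesis .
    qed
    \<comment> \<open>The bound does not depend on \<open>b\<close>, so it passes to the limit
      \<open>b\<close> to infinity.\<close>
    then have "eventually (\<lambda>b. norm (x b - x t) \<le> Q * W t powr (1 - \<theta>)) at_top"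
      by (auto simp: eventually_at_top_dense)
    moreover have "((\<lambda>b. norm (x b - x t)) \<longlongrightarrow> norm (xbar - x t)) at_top"
      by (intro tendsto_intros x_lim)
    ultimately show ?thesis
      by (metis norm_minus_commute tendsto_upperbound trivial_limit_at_top_linorder)
  qed
  have w_le_W: "w t \<le> - (\<kappa> / C\<^sup>2) * t * W t powr (2 * \<theta>)" if "t \<ge> t1" for t
  proof -
    have "W t powr (2 * \<theta>) = (W t powr \<theta>)\<^sup>2"
      by (simp add: power2_eq_square flip: powr_add)
    also have "\<dots> \<le> (C * d t)\<^sup>2" using W_le[OF that] by (intro power_mono) auto
    finally have "\<kappa> * t / C\<^sup>2 * W t powr (2 * \<theta>) \<le> \<kappa> * t / C\<^sup>2 * (C * d t)\<^sup>2"
      using that assms(1-3) by (intro mult_left_mono) auto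
    also have "\<dots> = \<kappa> * t * (d t)\<^sup>2" using \<open>C > 0\<close> by (simp add: power_mult_distrib)
    finally show ?thesis using w_le[OF that] by (simp add: mult_ac)
  qed
  define k where "k = \<kappa> / C\<^sup>2"
  have "k > 0" unfolding k_def using assms by simp
  show "\<exists>a1>0. \<exists>a2>0. \<exists>t'\<ge>t1. \<forall>t\<ge>t'. norm (x t - xbar) \<le> a1 * exp (- a2 * t\<^sup>2)"
    if "\<theta> = 1/2"
  proof (cases "\<exists>t2\<ge>t1. W t2 = 0")
    case True
    then obtain t' where "t' \<ge> t1" "\<forall>t\<ge>t'. x t = xbar" using stationary by blast
    then show ?thesis by (intro exI[of _ 1] exI[of _ t'] conjI) auto
  next
    case False
    then have Wpos: "W s > 0" if "s \<ge> t1" for s using W_nonneg that by (metis less_eq_real_def)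
    define B where "B = W t1 * exp (k / 2 * t1\<^sup>2)"
    have "B > 0" unfolding B_def using Wpos by simp
    \<comment> \<open>Here \<open>2 * \<theta> = 1\<close>, so the inequality for \<open>W\<close>
      is linear; the distance is of order \<open>sqrt (W t)\<close>, which halves the Gaussian
      exponent to \<open>k / 4\<close>.\<close>
    have "norm (x t - xbar) \<le> Q * sqrt B * exp (- (k / 4) * t\<^sup>2)" if t: "t \<ge> t1" for t
    proof -
      have "W t \<le> B * exp (- (k / 2) * t\<^sup>2)"
        unfolding B_def
      proof (rule gaussian_decay[where w' = w])
        show "w s \<le> - k * s * W s" if "t1 \<le> s" for s
          using w_le_W[OF that] Wpos[OF that] \<open>\<theta> = 1/2\<close> by (simp add: k_def)
      qed (use W_deriv t in auto)
      then have "sqrt (W t) \<le> sqrt (B * exp (- (k / 2) * t\<^sup>2))" by simp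
      also have "B * exp (- (k / 2) * t\<^sup>2) = B * (exp (- (k / 4) * t\<^sup>2))\<^sup>2"
        by (simp flip: exp_double)
      also have "sqrt \<dots> = sqrt B * exp (- (k / 4) * t\<^sup>2)" by (simp add: real_sqrt_mult)
      finally have "Q * sqrt (W t) \<le> Q * (sqrt B * exp (- (k / 4) * t\<^sup>2))"
        using \<open>Q > 0\<close> by (intro mult_left_mono) auto
      then show ?thesis
        using length_bound[OF Wpos t] Wpos[OF t] \<open>\<theta> = 1/2\<close> by (simp add: powr_half_sqrt mult.assoc)
    qed
    moreover have "Q * sqrt B > 0" "k / 4 > 0" using \<open>Q > 0\<close> \<open>B > 0\<close> \<open>k > 0\<close> by auto
    ultimately show ?thesis by blast
  qed
  show "\<exists>a3>0. \<exists>a4>0. \<exists>t'\<ge>t1. \<forall>t\<ge>t'. norm (x t - xbar)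
           \<le> (a3 * t\<^sup>2 + a4) powr (- ((1 - \<theta>) / (2 * \<theta> - 1)))"
    if "1/2 < \<theta>"
  proof (cases "\<exists>t2\<ge>t1. W t2 = 0")
    case True
    then obtain t' where "t' \<ge> t1" "\<forall>t\<ge>t'. x t = xbar" using stationary by blast
    then show ?thesis by (intro exI[of _ 1] exI[of _ t'] conjI) auto
  next
    case False
    then have Wpos: "W s > 0" if "s \<ge> t1" for s using W_nonneg that by (metis less_eq_real_def)
    \<comment> \<open>These satisfy \<open>1 + r = 2 * \<theta>\<close>,
      \<open>r * p = 1 - \<theta>\<close> and \<open>q powr (- p) = Q\<close>. Hence
      \<open>Q * W t powr (1 - \<theta>)\<close> equals
      \<open>(q * W t powr - r) powr (- p)\<close>, ready for the lower bound on
      \<open>W t powr - r\<close>.\<close>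
    define r where "r = 2 * \<theta> - 1"
    define p where "p = (1 - \<theta>) / r"
    define q where "q = Q powr (- 1 / p)"
    have "r > 0" using that by (simp add: r_def)
    have "p > 0" using \<open>r > 0\<close> \<theta> by (simp add: p_def)
    have "q > 0" using \<open>Q > 0\<close> by (simp add: q_def)
    have "norm (x t - xbar) \<le> (q * (r * k / 4) * t\<^sup>2 + q * W t1 powr - r) powr (- p)"
      if t: "t \<ge> 2 * t1" for t
    proof -
      have t': "t1 \<le> t" using t \<open>t1 > 0\<close> by simp
      \<comment> \<open>Waiting until \<open>2 * t1\<close> allows
        \<open>t\<^sup>2 - t1\<^sup>2\<close> to be replaced by \<open>t\<^sup>2 / 2\<close>;
        otherwise the negative term in \<open>t1\<^sup>2\<close> could spoil the positivity of
        \<open>a4\<close>.\<close>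
      have "(2 * t1)\<^sup>2 \<le> t\<^sup>2" using t \<open>t1 > 0\<close> by (intro power_mono) auto
      then have "4 * t1\<^sup>2 \<le> t\<^sup>2" by (simp add: power_mult_distrib)
      then have "t\<^sup>2 / 2 \<le> t\<^sup>2 - t1\<^sup>2" using zero_le_power2[of t1] by linarith
      then have "r * k / 2 * (t\<^sup>2 / 2) \<le> r * k / 2 * (t\<^sup>2 - t1\<^sup>2)"
        using \<open>r > 0\<close> \<open>k > 0\<close> by (intro mult_left_mono) auto
      moreover have "W t1 powr - r + r * k / 2 * (t\<^sup>2 - t1\<^sup>2) \<le> W t powr - r"
      proof (rule powr_decay[where w' = w])
        show "w s \<le> - k * s * W s powr (1 + r)" if "t1 \<le> s" for s
          using w_le_W[OF that] by (simp add: k_def r_def)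
      qed (use W_deriv Wpos \<open>r > 0\<close> t' in auto)
      ultimately have "r * k / 4 * t\<^sup>2 + W t1 powr - r \<le> W t powr - r" by argo
      then have "q * (r * k / 4 * t\<^sup>2 + W t1 powr - r) \<le> q * W t powr - r"
        using \<open>q > 0\<close> by (intro mult_left_mono) auto
      moreover have "0 < q * (r * k / 4 * t\<^sup>2 + W t1 powr - r)"
        using \<open>q > 0\<close> \<open>r > 0\<close> \<open>k > 0\<close> Wpos[of t1] by (intro mult_pos_pos add_nonneg_pos) auto
      ultimately have "(q * W t powr - r) powr (- p)
          \<le> (q * (r * k / 4 * t\<^sup>2 + W t1 powr - r)) powr (- p)"
        using \<open>p > 0\<close> by (intro powr_mono2') auto
      moreover have "(q * W t powr - r) powr (- p) = Q * W t powr (1 - \<theta>)"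
        using \<open>Q > 0\<close> \<open>p > 0\<close> \<open>r > 0\<close>
        by (simp add: powr_mult powr_powr q_def) (simp add: p_def)
      ultimately show ?thesis
        using length_bound[OF Wpos t'] by (simp add: distrib_left mult.assoc)
    qed
    moreover have "q * (r * k / 4) > 0" "q * W t1 powr - r > 0" "2 * t1 \<ge> t1"
      using \<open>q > 0\<close> \<open>r > 0\<close> \<open>k > 0\<close> Wpos[of t1] \<open>t1 > 0\<close> by auto
    ultimately show ?thesis unfolding p_def r_def by blast
  qed
qed

section \<open>From almost everywhere solutions to classical ones\<close>

lemma abs_continuous_on_interval_imp_continuous_on:
  assumes "abs_continuous_on_interval a b f"
  shows "continuous_on {a..b} f"
  unfolding continuous_on_iff
proof (intro ballI allI impI)
  fix s e :: real assume s: "s \<in> {a..b}" and "e > 0"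
  then obtain \<delta> where "\<delta> > 0" and \<delta>: "\<And>D :: (real \<times> real) set.
        finite D \<and> (\<forall>(c, d)\<in>D. a \<le> c \<and> c < d \<and> d \<le> b) \<and>
        disjoint_family_on (\<lambda>(c, d). {c<..<d}) D \<and> (\<Sum>(c, d)\<in>D. d - c) < \<delta> \<Longrightarrow>
        (\<Sum>(c, d)\<in>D. norm (f d - f c)) < e"
    using assms[unfolded abs_continuous_on_interval_def, rule_format, OF \<open>e > 0\<close>] by blast
  have "dist (f t) (f s) < e" if t: "t \<in> {a..b}" "dist t s < \<delta>" for t
  proof (cases "t = s")
    case False
    \<comment> \<open>A family with one interval suffices; \<open>min\<close> and \<open>max\<close>
      treat both orders of \<open>s\<close> and \<open>t\<close> at once.\<close>
    then have "(\<Sum>(c, d)\<in>{(min t s, max t s)}. norm (f d - f c)) < e"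
      using s t by (intro \<delta>) (auto simp: disjoint_family_on_def dist_real_def)
    then show ?thesis
      by (cases "t \<le> s") (auto simp: dist_norm min_def max_def norm_minus_commute)
  qed (use \<open>e > 0\<close> in simp)
  with \<open>\<delta> > 0\<close> show "\<exists>d>0. \<forall>t\<in>{a..b}. dist t s < d \<longrightarrow> dist (f t) (f s) < e" by blast
qed

lemma locally_abs_continuous_from_imp_continuous_on:
  assumes "locally_abs_continuous_from t0 f"
  shows "continuous_on {t0<..} f"
proof (rule continuous_at_imp_continuous_on, rule ballI)
  fix t assume "t \<in> {t0<..}"
  then have "abs_continuous_on_interval t0 (t + 1) f"
    using assms unfolding locally_abs_continuous_from_def by auto
  then have "continuous_on {t0..t + 1} f"
    by (rule abs_continuous_on_interval_imp_continuous_on)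
  then show "isCont f t"
    by (rule continuous_on_interior) (use \<open>t \<in> {t0<..}\<close> in simp)
qed

text \<open>By continuity, the equation required almost everywhere holds at every interior time.\<close>

lemma strong_global_solution_ode:
  assumes "strong_global_solution lam \<gamma> g t0 u0 v0 x" "t0 > 0"
    and "continuous_on UNIV (gradient g)"
  obtains x' x'' where
    "\<And>t. t > t0 \<Longrightarrow> (x has_vector_derivative x' t) (at t)"
    "\<And>t. t > t0 \<Longrightarrow> (x' has_vector_derivative x'' t) (at t)"
    "\<And>t. t > t0 \<Longrightarrow> (lam / t\<^sup>2) *\<^sub>R x'' t + (\<gamma> / t) *\<^sub>R x' t + gradient g (x t) = 0"
proof -
  obtain x' x'' where
    x': "\<forall>t\<ge>t0. (x has_vector_derivative x' t) (at t within {t0..})" and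
    x'': "\<forall>t\<ge>t0. (x' has_vector_derivative x'' t) (at t within {t0..})" and
    ac: "locally_abs_continuous_from t0 x" "locally_abs_continuous_from t0 x'"
      "locally_abs_continuous_from t0 x''" and
    ae: "AE t in lebesgue. t \<ge> t0 \<longrightarrow>
           (lam / t\<^sup>2) *\<^sub>R x'' t + (\<gamma> / t) *\<^sub>R x' t + gradient g (x t) = 0"
    using assms(1) unfolding strong_global_solution_def by blast
  let ?F = "\<lambda>t. (lam / t\<^sup>2) *\<^sub>R x'' t + (\<gamma> / t) *\<^sub>R x' t + gradient g (x t)"
  have at: "at t within {t0..} = at t" if "t > t0" for t
    by (rule at_within_interior) (use that in simp)
  have "continuous_on {t0<..} (\<lambda>t. gradient g (x t))"
    by (rule continuous_on_compose2[OF assms(3)])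
      (use ac locally_abs_continuous_from_imp_continuous_on in auto)
  then have cont: "continuous_on {t0<..} ?F"
    using assms(2) ac[THEN locally_abs_continuous_from_imp_continuous_on]
    by (intro continuous_intros) auto
  have "t \<in> {t \<in> {t0<..}. ?F t \<in> {0}} \<union> {..t0}" if "t > t0" for t
  proof (rule ccontr)
    assume t: "t \<notin> {t \<in> {t0<..}. ?F t \<in> {0}} \<union> {..t0}"
    \<comment> \<open>The times after \<open>t0\<close> at which the equation fails form an open set
      of measure zero, which must be empty.\<close>
    let ?U = "{t0<..} \<inter> ?F -` (- {0})"
    have "open ?U"
      by (rule continuous_open_preimage[OF cont]) auto
    moreover have "AE s\<in>?U in lebesgue. s \<in> {}"
      using ae by eventually_elim auto
    moreover have "t \<in> ?U" using t that by auto
    ultimately show False using mem_closed_if_AE_lebesgue_open[of ?U "{}" t] by auto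
  qed
  then have "?F t = 0" if "t > t0" for t using that by force
  then show ?thesis using that[of x' x''] x' x'' at by (metis less_imp_le)
qed

section \<open>Differentiation along curves and elementary estimates\<close>

lemma gderiv_chain:
  assumes "GDERIV g (f t) :> D" "(f has_vector_derivative f') (at t)"
  shows "((\<lambda>s. g (f s)) has_real_derivative inner f' D) (at t)"
proof -
  have "((\<lambda>s. g (f s)) has_derivative (\<lambda>h. inner (h *\<^sub>R f') D)) (at t)"
    using assms unfolding gderiv_def has_vector_derivative_def
    by (rule has_derivative_compose[rotated])
  then show ?thesis
    by (simp add: has_field_derivative_def mult.commute[of _ "inner f' D"])
qed

text \<open>Mean value inequality on the segment from \<open>a\<close> to \<open>a + h\<close>,
  where the gradient differs from \<open>G a\<close> by at most \<open>L * norm h\<close>. With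
  \<open>a = x t\<close> and \<open>h = v t\<close> the right-hand side is quadratic in the gradient
  and the velocity, as the comparison of \<open>W\<close> with \<open>d\<close> requires.\<close>

lemma lipschitz_gradient_bound:
  fixes g :: "'a::real_inner \<Rightarrow> real"
  assumes g: "\<And>z. GDERIV g z :> G z" and "L-lipschitz_on UNIV G"
  shows "\<bar>g (a + h) - g a\<bar> \<le> (norm (G a) + L * norm h) * norm h"
proof -
  have "L \<ge> 0" using assms(2) by (rule lipschitz_on_nonneg)
  have "norm (g (a + h) - g a) \<le> norm h * (norm (G a) + L * norm h)"
  proof (rule differentiable_bound_segment[where G = UNIV])
    show "(g has_derivative (\<lambda>k. inner k (G z))) (at z)" for z
      using g unfolding gderiv_def .
    fix s :: real assume s: "s \<in> {0..1}"
    have "norm (G (a + s *\<^sub>R h) - G a) \<le> L * norm (s *\<^sub>R h)"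
      using lipschitz_on_normD[OF assms(2), of "a + s *\<^sub>R h" a] by simp
    also have "\<dots> \<le> L * norm h"
      using s \<open>L \<ge> 0\<close> by (intro mult_left_mono) (auto intro: mult_left_le_one_le)
    finally have "norm (G (a + s *\<^sub>R h)) \<le> norm (G a) + L * norm h"
      using norm_triangle_sub[of "G (a + s *\<^sub>R h)" "G a"] by simp
    moreover have "onorm (\<lambda>k. inner k (G (a + s *\<^sub>R h))) \<le> norm (G (a + s *\<^sub>R h))"
      by (rule onorm_bound) (simp, metis Cauchy_Schwarz_ineq2 mult.commute real_norm_def)
    ultimately show "onorm (\<lambda>k. inner k (G (a + s *\<^sub>R h))) \<le> norm (G a) + L * norm h"
      by linarith
  qed auto
  then show ?thesis by (simp add: mult.commute)
qed

lemma young_ineq: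
  fixes a b k :: real
  assumes "k > 0"
  shows "a * b \<le> k / 2 * a\<^sup>2 + b\<^sup>2 / (2 * k)"
proof -
  have "0 \<le> (k * a - b)\<^sup>2 / (2 * k)" using assms by simp
  also have "\<dots> = k / 2 * a\<^sup>2 + b\<^sup>2 / (2 * k) - a * b"
    using assms by (simp add: power2_eq_square field_simps)
  finally show ?thesis by simp
qed

section \<open>Vanishing velocity and the Lyapunov function\<close>

text \<open>Once \<open>|F|\<^sup>2 < \<gamma>\<^sup>2 * \<epsilon>\<close>, half of the friction
  absorbs the forcing up to a constant, and \<open>|v|\<^sup>2 - \<epsilon>\<close> satisfies the
  inequality of \<open>gaussian_decay\<close>. The conclusion is what makes the Lyapunov function
  tend to zero.\<close>

lemma damped_velocity_tendsto_0:
  fixes v F :: "real \<Rightarrow> 'a::real_inner"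
  assumes "t0 > 0" "lam > 0" "\<gamma> > 0"
    and c: "\<And>t. t > t0 \<Longrightarrow> c t \<ge> \<gamma>"
    and v_deriv: "\<And>t. t > t0 \<Longrightarrow>
      (v has_vector_derivative - (t / lam) *\<^sub>R (c t *\<^sub>R v t + F t)) (at t)"
    and F: "(F \<longlongrightarrow> 0) at_top"
  shows "(v \<longlongrightarrow> 0) at_top"
proof -
  have "((\<lambda>t. inner (v t) (v t)) \<longlongrightarrow> 0) at_top"
  proof (rule tendstoI)
    fix e :: real assume "e > 0"
    \<comment> \<open>One half of \<open>e\<close> is subtracted from \<open>|v|\<^sup>2\<close>,
      the other half bounds the decaying remainder.\<close>
    define \<epsilon> where "\<epsilon> = e / 2"
    have "\<epsilon> > 0" using \<open>e > 0\<close> by (simp add: \<epsilon>_def)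
    let ?k = "\<gamma> / lam"
    have "((\<lambda>t. (norm (F t))\<^sup>2) \<longlongrightarrow> (norm (0 :: 'a))\<^sup>2) at_top"
      by (intro tendsto_intros F)
    then have "eventually (\<lambda>t. (norm (F t))\<^sup>2 < \<gamma>\<^sup>2 * \<epsilon>) at_top"
      by (rule order_tendstoD) (use \<open>\<gamma> > 0\<close> \<open>\<epsilon> > 0\<close> in auto)
    then have "eventually (\<lambda>t. t > t0 \<and> (norm (F t))\<^sup>2 < \<gamma>\<^sup>2 * \<epsilon>) at_top"
      by (intro eventually_conj eventually_gt_at_top)
    then obtain t1 where t1: "\<And>t. t \<ge> t1 \<Longrightarrow> t > t0 \<and> (norm (F t))\<^sup>2 < \<gamma>\<^sup>2 * \<epsilon>"
      by (auto simp: eventually_at_top_linorder)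
    let ?u = "\<lambda>t. inner (v t) (v t) - \<epsilon>"
    let ?u' = "\<lambda>t. - (2 * t / lam) * (c t * (norm (v t))\<^sup>2 + inner (v t) (F t))"
    have u_deriv: "(?u has_real_derivative ?u' t) (at t)" if "t > t0" for t
      unfolding has_real_derivative_iff_has_vector_derivative
      by (rule has_vector_derivative_eq_rhs[OF has_vector_derivative_diff[OF
              bounded_bilinear.has_vector_derivative[OF bounded_bilinear_inner
                v_deriv[OF that] v_deriv[OF that]] has_vector_derivative_const]])
        (simp add: inner_commute power2_norm_eq_inner algebra_simps)
    have u_le: "?u' t \<le> - ?k * t * ?u t" if "t \<ge> t1" for t
    proof -
      have t: "t > t0" "(norm (F t))\<^sup>2 < \<gamma>\<^sup>2 * \<epsilon>" using t1[OF that] by auto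
      have "- inner (v t) (F t) \<le> norm (v t) * norm (F t)"
        using norm_cauchy_schwarz[of "- v t" "F t"] by simp
      also have "\<dots> \<le> \<gamma> / 2 * (norm (v t))\<^sup>2 + (norm (F t))\<^sup>2 / (2 * \<gamma>)"
        by (rule young_ineq[OF \<open>\<gamma> > 0\<close>])
      also have "(norm (F t))\<^sup>2 / (2 * \<gamma>) \<le> \<gamma> / 2 * \<epsilon>"
        using t(2) \<open>\<gamma> > 0\<close> by (simp add: field_simps power2_eq_square)
      finally have "\<gamma> / 2 * ?u t \<le> \<gamma> * (norm (v t))\<^sup>2 + inner (v t) (F t)"
        by (simp add: power2_norm_eq_inner algebra_simps)
      also have "\<dots> \<le> c t * (norm (v t))\<^sup>2 + inner (v t) (F t)"
        using c[OF t(1)] by (simp add: mult_right_mono)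
      finally have "(2 * t / lam) * (\<gamma> / 2 * ?u t)
          \<le> (2 * t / lam) * (c t * (norm (v t))\<^sup>2 + inner (v t) (F t))"
        using t(1) \<open>t0 > 0\<close> \<open>lam > 0\<close> by (intro mult_left_mono) auto
      moreover have "(2 * t / lam) * (\<gamma> / 2 * ?u t) = ?k * t * ?u t" by simp
      ultimately have "?k * t * ?u t
          \<le> (2 * t / lam) * (c t * (norm (v t))\<^sup>2 + inner (v t) (F t))" by argo
      then show ?thesis by (simp only: mult_minus_left neg_le_iff_le)
    qed
    let ?B = "\<lambda>t. ?u t1 * exp (?k / 2 * t1\<^sup>2) * exp (- (?k / 2) * t\<^sup>2)"
    have decay: "?u t \<le> ?B t" if "t \<ge> t1" for t
      by (rule gaussian_decay[OF u_deriv u_le that]) (use t1 in auto)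
    have "filterlim (\<lambda>t. ?k / 2 * t\<^sup>2) at_top at_top"
      using \<open>\<gamma> > 0\<close> \<open>lam > 0\<close>
      by (intro filterlim_tendsto_pos_mult_at_top[OF tendsto_const] filterlim_pow_at_top
          filterlim_ident) auto
    then have "((\<lambda>t. exp (- (?k / 2 * t\<^sup>2))) \<longlongrightarrow> 0) at_top"
      by (intro filterlim_compose[OF exp_at_bot]) (simp add: filterlim_uminus_at_bot)
    then have "(?B \<longlongrightarrow> ?u t1 * exp (?k / 2 * t1\<^sup>2) * 0) at_top"
      by (intro tendsto_intros) simp
    then have "eventually (\<lambda>t. ?B t < \<epsilon>) at_top"
      by (rule order_tendstoD) (use \<open>\<epsilon> > 0\<close> in simp)
    then show "eventually (\<lambda>t. dist (inner (v t) (v t)) 0 < e) at_top"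
      using eventually_ge_at_top[of t1]
    proof eventually_elim
      case (elim t)
      then have "inner (v t) (v t) < e" using decay[of t] by (simp add: \<epsilon>_def)
      then show ?case by simp
    qed
  qed
  then have "((\<lambda>t. sqrt (inner (v t) (v t))) \<longlongrightarrow> sqrt 0) at_top"
    by (rule tendsto_real_sqrt)
  then show ?thesis
    by (simp add: tendsto_norm_zero_iff flip: norm_eq_sqrt_inner)
qed

text \<open>The second summand evaluates \<open>g\<close> at the shifted point \<open>x + v\<close>: its derivative
  contributes \<open>- |G x|\<^sup>2\<close> although \<open>G\<close> itself need not be differentiable.\<close>

lemma lyapunov_function:
  fixes g :: "'a::real_inner \<Rightarrow> real" and x v :: "real \<Rightarrow> 'a"
  assumes g: "\<And>z. GDERIV g z :> G z" and lip: "L-lipschitz_on UNIV G"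
    and "t0 > 0" "lam > 0" "\<gamma> > 0"
    and c: "\<And>t. t > t0 \<Longrightarrow> \<gamma> \<le> c t \<and> c t \<le> M"
    and x_deriv: "\<And>t. t > t0 \<Longrightarrow> (x has_vector_derivative t *\<^sub>R v t) (at t)"
    and v_deriv: "\<And>t. t > t0 \<Longrightarrow>
      (v has_vector_derivative - (t / lam) *\<^sub>R (c t *\<^sub>R v t + G (x t))) (at t)"
  obtains A w where "A > 0"
    "\<And>t. t > t0 \<Longrightarrow>
      ((\<lambda>t. A * (g (x t) + lam / 2 * (norm (v t))\<^sup>2) + g (x t + v t)) has_real_derivative w t) (at t)"
    "\<And>t. t > t0 \<Longrightarrow> w t \<le> - (1 / (2 * lam)) * t * ((norm (G (x t)))\<^sup>2 + (norm (v t))\<^sup>2)"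
proof -
  have "L \<ge> 0" using lip by (rule lipschitz_on_nonneg)
  \<comment> \<open>\<open>B\<close> bounds \<open>\<bar>1 - c t / lam\<bar>\<close>, and
    \<open>P\<close> collects the coefficients of the cross term \<open>|G x| |v|\<close>.
    \<open>A\<close> is fixed by requiring that the friction \<open>A * \<gamma>\<close> pay for
    every \<open>|v|\<^sup>2\<close> term and leave \<open>1 / (2 * lam)\<close> over.\<close>
  define B where "B = 1 + M / lam"
  define P where "P = B + L / lam"
  have "M > 0" using c[of "t0 + 1"] \<open>\<gamma> > 0\<close> by simp
  have "B > 0" using \<open>M > 0\<close> \<open>lam > 0\<close> by (simp add: B_def add_pos_pos)
  define A where "A = (lam / 2 * P\<^sup>2 + L * B + 1 / (2 * lam)) / \<gamma>"
  have "A > 0"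
    unfolding A_def using \<open>lam > 0\<close> \<open>\<gamma> > 0\<close> \<open>L \<ge> 0\<close> \<open>B > 0\<close>
    by (intro divide_pos_pos add_nonneg_pos) auto
  define w where "w t = A * (- t * c t * (norm (v t))\<^sup>2)
    + inner (t *\<^sub>R v t + - (t / lam) *\<^sub>R (c t *\<^sub>R v t + G (x t))) (G (x t + v t))" for t
  show ?thesis
  proof (rule that[OF \<open>A > 0\<close>, of w])
    fix t :: real assume t: "t > t0"
    then have "t > 0" using \<open>t0 > 0\<close> by simp
    let ?v' = "- (t / lam) *\<^sub>R (c t *\<^sub>R v t + G (x t))"
    have 1: "((\<lambda>t. g (x t)) has_real_derivative inner (t *\<^sub>R v t) (G (x t))) (at t)"
      by (rule gderiv_chain[OF g x_deriv[OF t]])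
    have 2: "((\<lambda>t. g (x t + v t)) has_real_derivative inner (t *\<^sub>R v t + ?v') (G (x t + v t))) (at t)"
      by (rule gderiv_chain[OF g has_vector_derivative_add[OF x_deriv[OF t] v_deriv[OF t]]])
    have 3: "((\<lambda>t. (norm (v t))\<^sup>2) has_real_derivative inner (v t) ?v' + inner ?v' (v t)) (at t)"
      unfolding power2_norm_eq_inner has_real_derivative_iff_has_vector_derivative
      by (rule bounded_bilinear.has_vector_derivative[OF bounded_bilinear_inner
            v_deriv[OF t] v_deriv[OF t]])
    \<comment> \<open>Energy balance: the factor \<open>lam / 2\<close> makes the two products of
      \<open>v\<close> and \<open>G x\<close> cancel, so only friction remains.\<close>
    have "inner (t *\<^sub>R v t) (G (x t)) + lam / 2 * (inner (v t) ?v' + inner ?v' (v t))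
        = - t * c t * (norm (v t))\<^sup>2"
      using \<open>lam > 0\<close>
      by (simp add: inner_commute[of "G (x t)"] inner_diff_left inner_diff_right power2_norm_eq_inner field_simps)
    then show "((\<lambda>t. A * (g (x t) + lam / 2 * (norm (v t))\<^sup>2) + g (x t + v t))
        has_real_derivative w t) (at t)"
      unfolding w_def
      using DERIV_add[OF DERIV_cmult[OF DERIV_add[OF 1 DERIV_cmult[OF 3]]] 2, of A "lam / 2"] by simp
    let ?a = "norm (G (x t))" and ?b = "norm (v t)"
    \<comment> \<open>The velocity of \<open>x + v\<close> is \<open>t\<close> times
      \<open>?s *\<^sub>R v t - (1 / lam) *\<^sub>R G (x t)\<close>. The two terms are estimated
      separately, with \<open>?e\<close> the error of replacing the gradient at \<open>x + v\<close>
      by the one at \<open>x\<close>.\<close>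
    let ?e = "G (x t + v t) - G (x t)" and ?s = "1 - c t / lam"
    have e: "norm ?e \<le> L * ?b"
      using lipschitz_on_normD[OF lip, of "x t + v t" "x t"] by simp
    have s: "\<bar>?s\<bar> \<le> B"
      using c[OF t] \<open>\<gamma> > 0\<close> \<open>lam > 0\<close> \<open>M > 0\<close>
      by (auto simp: B_def abs_le_iff divide_right_mono field_simps)
    have "inner (?s *\<^sub>R v t) (G (x t + v t)) \<le> norm (?s *\<^sub>R v t) * norm (G (x t + v t))"
      by (rule norm_cauchy_schwarz)
    also have "\<dots> \<le> (B * ?b) * (?a + L * ?b)"
      using s e norm_triangle_sub[of "G (x t + v t)" "G (x t)"] \<open>B > 0\<close>
      by (intro mult_mono) (auto intro: mult_right_mono)
    finally have i1: "inner (?s *\<^sub>R v t) (G (x t + v t)) \<le> (B * ?b) * (?a + L * ?b)" .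
    \<comment> \<open>Writing \<open>G (x t + v t)\<close> as \<open>G (x t) + ?e\<close> produces
      the wanted \<open>- |G x|\<^sup>2\<close> and a cross term.\<close>
    have "- inner (G (x t)) ?e \<le> ?a * norm ?e"
      using norm_cauchy_schwarz[of "- G (x t)" ?e] by simp
    also have "\<dots> \<le> ?a * (L * ?b)" by (intro mult_left_mono e) auto
    finally have "- inner (G (x t)) (G (x t + v t)) \<le> ?a * (L * ?b) - ?a\<^sup>2"
      by (simp add: inner_diff_right power2_norm_eq_inner)
    then have i2: "- inner (G (x t)) (G (x t + v t)) / lam \<le> (?a * (L * ?b) - ?a\<^sup>2) / lam"
      using \<open>lam > 0\<close> by (intro divide_right_mono) auto
    \<comment> \<open>The weight \<open>1 / lam\<close> spends exactly half of the available
      \<open>- ?a\<^sup>2 / lam\<close> on the cross term.\<close>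
    have i3: "?a * (P * ?b) \<le> (1 / lam) / 2 * ?a\<^sup>2 + (P * ?b)\<^sup>2 / (2 * (1 / lam))"
      by (rule young_ineq) (use \<open>lam > 0\<close> in simp)
    have "inner (t *\<^sub>R v t + ?v') (G (x t + v t))
        = t * (inner (?s *\<^sub>R v t) (G (x t + v t)) + - inner (G (x t)) (G (x t + v t)) / lam)"
      by (simp add: algebra_simps diff_divide_distrib)
    also have "\<dots> \<le> t * ((B * ?b) * (?a + L * ?b) + (?a * (L * ?b) - ?a\<^sup>2) / lam)"
      using \<open>t > 0\<close> i1 i2 by (intro mult_left_mono add_mono) auto
    also have "\<dots> = t * (?a * (P * ?b) + L * B * ?b\<^sup>2 - ?a\<^sup>2 / lam)"
      by (simp add: P_def power2_eq_square algebra_simps diff_divide_distrib add_divide_distrib)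
    also have "\<dots> \<le> t * ((1 / lam) / 2 * ?a\<^sup>2 + (P * ?b)\<^sup>2 / (2 * (1 / lam)) + L * B * ?b\<^sup>2 - ?a\<^sup>2 / lam)"
      using \<open>t > 0\<close> i3 by (intro mult_left_mono) auto
    also have "\<dots> = t * ((lam / 2 * P\<^sup>2 + L * B) * ?b\<^sup>2 - 1 / (2 * lam) * ?a\<^sup>2)"
      by (simp add: algebra_simps)
    also have "lam / 2 * P\<^sup>2 + L * B = A * \<gamma> - 1 / (2 * lam)"
      using \<open>\<gamma> > 0\<close> by (simp add: A_def)
    finally have "w t \<le> A * (- t * c t * ?b\<^sup>2) + t * ((A * \<gamma> - 1 / (2 * lam)) * ?b\<^sup>2 - 1 / (2 * lam) * ?a\<^sup>2)"
      unfolding w_def by simp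
    also have "A * (- t * c t * ?b\<^sup>2) \<le> A * (- t * \<gamma> * ?b\<^sup>2)"
      using c[OF t] \<open>t > 0\<close> \<open>A > 0\<close> by (auto intro!: mult_left_mono mult_right_mono)
    finally show "w t \<le> - (1 / (2 * lam)) * t * (?a\<^sup>2 + ?b\<^sup>2)"
      by (simp add: algebra_simps)
  qed
qed

text \<open>Here \<open>a\<close>, \<open>b\<close> and \<open>r\<close> stand for
  \<open>|G x|\<close>, \<open>|v|\<close> and \<open>|g x - g xbar|\<close>. The Lojasiewicz
  inequality bounds \<open>r\<close> by a multiple of \<open>d powr (1 / \<theta>)\<close>, where
  \<open>d\<^sup>2 = a\<^sup>2 + b\<^sup>2\<close>. The other terms are of order
  \<open>d\<^sup>2\<close>, which is no larger because \<open>d \<le> 1\<close> and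
  \<open>1 / \<theta> \<le> 2\<close>. Raising to the power \<open>\<theta>\<close> leaves a
  multiple of \<open>d\<close>.\<close>

lemma lojasiewicz_lyapunov_bound:
  fixes a b r A L K lam \<theta> W :: real
  assumes "A > 0" "lam > 0" "L \<ge> 0" "K > 0" and \<theta>: "1/2 \<le> \<theta>" "\<theta> < 1"
    and "0 \<le> a" "0 \<le> b" "0 \<le> r" and le1: "a\<^sup>2 + b\<^sup>2 \<le> 1"
    and loj: "r powr \<theta> \<le> K * a"
    and W: "\<bar>W\<bar> \<le> (A + 1) * r + A * (lam / 2) * b\<^sup>2 + (a + L * b) * b"
  shows "\<bar>W\<bar> powr \<theta>
    \<le> ((A + 1) * K powr (1 / \<theta>) + (A * (lam / 2) + 1 + L)) powr \<theta> * sqrt (a\<^sup>2 + b\<^sup>2)"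
proof -
  let ?d = "sqrt (a\<^sup>2 + b\<^sup>2)"
  let ?C = "A * (lam / 2) + 1 + L"
  have d: "0 \<le> ?d" "?d \<le> 1" "a \<le> ?d" "b \<le> ?d"
    using le1 real_sqrt_sum_squares_ge1 real_sqrt_sum_squares_ge2 by auto
  have "K * a \<le> K * ?d" using d \<open>K > 0\<close> by (intro mult_left_mono) auto
  then have "(r powr \<theta>) powr (1 / \<theta>) \<le> (K * ?d) powr (1 / \<theta>)"
    using loj \<theta> by (intro powr_mono2) auto
  then have r: "r \<le> K powr (1 / \<theta>) * ?d powr (1 / \<theta>)"
    using \<theta> \<open>0 \<le> r\<close> \<open>K > 0\<close> d by (simp add: powr_powr powr_mult)
  \<comment> \<open>Zero is a separate case because \<open>powr_realpow\<close> needs a positive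
    base.\<close>
  have "?d\<^sup>2 = ?d powr 2" using d(1) by (cases "?d = 0") (auto simp: powr_realpow)
  also have "\<dots> \<le> ?d powr (1 / \<theta>)" using d \<theta> by (intro powr_mono') (auto simp: field_simps)
  finally have D: "?d\<^sup>2 \<le> ?d powr (1 / \<theta>)" .
  have b2: "b\<^sup>2 \<le> ?d\<^sup>2" using d \<open>0 \<le> b\<close> by (intro power_mono)
  have "a * b \<le> ?d\<^sup>2"
    unfolding power2_eq_square[of ?d] using d \<open>0 \<le> b\<close> by (intro mult_mono)
  moreover have "A * (lam / 2) * b\<^sup>2 \<le> A * (lam / 2) * ?d\<^sup>2" "L * b\<^sup>2 \<le> L * ?d\<^sup>2"
    using b2 \<open>A > 0\<close> \<open>lam > 0\<close> \<open>L \<ge> 0\<close> by (auto intro!: mult_left_mono)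
  moreover have "(a + L * b) * b = a * b + L * b\<^sup>2" by (simp add: power2_eq_square algebra_simps)
  moreover have "?C * ?d\<^sup>2 = A * (lam / 2) * ?d\<^sup>2 + ?d\<^sup>2 + L * ?d\<^sup>2" by (simp only: distrib_right mult_1)
  ultimately have "\<bar>W\<bar> \<le> (A + 1) * r + ?C * ?d\<^sup>2" using W by linarith
  also have "\<dots> \<le> (A + 1) * (K powr (1 / \<theta>) * ?d powr (1 / \<theta>)) + ?C * ?d powr (1 / \<theta>)"
    using r D \<open>A > 0\<close> \<open>lam > 0\<close> \<open>L \<ge> 0\<close> by (intro add_mono mult_left_mono) auto
  also have "\<dots> = ((A + 1) * K powr (1 / \<theta>) + ?C) * ?d powr (1 / \<theta>)"
    by (simp add: algebra_simps)
  finally have "\<bar>W\<bar> powr \<theta> \<le> (((A + 1) * K powr (1 / \<theta>) + ?C) * ?d powr (1 / \<theta>)) powr \<theta>"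
    using \<theta> by (intro powr_mono2) auto
  also have "\<dots> = ((A + 1) * K powr (1 / \<theta>) + ?C) powr \<theta> * ?d"
    by (subst powr_mult) (use d \<theta> in \<open>simp add: powr_powr\<close>)
  finally show ?thesis .
qed

section \<open>Application of the abstract rates to the trajectory\<close>

theorem corollary5p2:
  fixes g :: "real ^ 'n \<Rightarrow> real"
    and x :: "real \<Rightarrow> real ^ 'n"
    and u0 v0 xbar :: "real ^ 'n"
    and t0 lam \<gamma> \<theta> :: real
  assumes "t0 > 0" and "lam > 0" and "\<gamma> > 0"
    and "g differentiable_on UNIV"
    and "\<exists>L. L-lipschitz_on UNIV (gradient g)"
    and "bdd_below (range g)"
    and "strong_global_solution lam \<gamma> g t0 u0 v0 x"
    and "bounded (x ` {t0..})"
    and "xbar \<in> crit g"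
    and "(x \<longlongrightarrow> xbar) at_top"
    and "lojasiewicz_property g xbar \<theta>"
    and "1/2 \<le> \<theta>" and "\<theta> < 1"
  shows "(\<theta> = 1/2 \<longrightarrow>
            (\<exists>a1>0. \<exists>a2>0. \<exists>t'>0. t0 \<le> t' \<and>
               (\<forall>t\<ge>t'. norm (x t - xbar) \<le> a1 * exp (- a2 * t\<^sup>2))))
       \<and> (1/2 < \<theta> \<longrightarrow>
            (\<exists>a3>0. \<exists>a4>0. \<exists>t'>0. t0 \<le> t' \<and>
               (\<forall>t\<ge>t'. norm (x t - xbar)
                  \<le> (a3 * t\<^sup>2 + a4) powr (- ((1 - \<theta>) / (2 * \<theta> - 1))))))"
proof -
  let ?G = "gradient g"
  obtain L where lip: "L-lipschitz_on UNIV ?G" using assms(5) by blast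
  have "L \<ge> 0" using lip by (rule lipschitz_on_nonneg)
  have g: "GDERIV g z :> ?G z" for z
    using assms(4) by (intro gderiv_gradient) (auto simp: differentiable_on_def)
  have g_cont: "isCont g z" for z
    using g[of z] unfolding gderiv_def by (rule has_derivative_continuous)
  have G_cont: "continuous_on UNIV ?G"
    using lip by (rule lipschitz_on_continuous_on)
  obtain x' x'' where
    x': "\<And>t. t > t0 \<Longrightarrow> (x has_vector_derivative x' t) (at t)" and
    x'': "\<And>t. t > t0 \<Longrightarrow> (x' has_vector_derivative x'' t) (at t)" and
    ode: "\<And>t. t > t0 \<Longrightarrow> (lam / t\<^sup>2) *\<^sub>R x'' t + (\<gamma> / t) *\<^sub>R x' t + ?G (x t) = 0"
    using strong_global_solution_ode[OF assms(7) assms(1) G_cont] by blast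
  define v where "v t = (1 / t) *\<^sub>R x' t" for t
  \<comment> \<open>From \<open>x' = t v\<close> one has \<open>x'' = v + t v'\<close>; the summand
    \<open>v\<close> adds \<open>lam / t\<^sup>2\<close> to the friction.\<close>
  define c where "c t = \<gamma> + lam / t\<^sup>2" for t
  have x_deriv: "(x has_vector_derivative t *\<^sub>R v t) (at t)" if "t > t0" for t
    using x'[OF that] that \<open>t0 > 0\<close> by (simp add: v_def)
  have v_deriv: "(v has_vector_derivative - (t / lam) *\<^sub>R (c t *\<^sub>R v t + ?G (x t))) (at t)"
    if "t > t0" for t
  proof -
    have "t > 0" using that \<open>t0 > 0\<close> by simp
    have "((\<lambda>t. 1 / t) has_real_derivative - (1 / t\<^sup>2)) (at t)"
      using \<open>t > 0\<close> by (auto intro!: derivative_eq_intros simp: power2_eq_square)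
    then have "(v has_vector_derivative (1 / t) *\<^sub>R x'' t + (- (1 / t\<^sup>2)) *\<^sub>R x' t) (at t)"
      unfolding v_def by (intro has_vector_derivative_scaleR x'' that)
    moreover have G: "?G (x t) = - ((lam / t\<^sup>2) *\<^sub>R x'' t + (\<gamma> / t) *\<^sub>R x' t)"
      using ode[OF that] by (metis add_eq_0_iff)
    have "- (t / lam) *\<^sub>R (c t *\<^sub>R v t + ?G (x t))
        = (t / lam * (lam / t\<^sup>2)) *\<^sub>R x'' t
          + (t / lam * (\<gamma> / t) - t / lam * (c t / t)) *\<^sub>R x' t"
      unfolding v_def G by (simp add: algebra_simps)
    moreover have "t / lam * (lam / t\<^sup>2) = 1 / t"
      "t / lam * (\<gamma> / t) - t / lam * (c t / t) = - (1 / t\<^sup>2)"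
      using \<open>t > 0\<close> \<open>lam > 0\<close> by (auto simp: c_def field_simps power2_eq_square)
    ultimately show ?thesis by simp
  qed
  have c: "\<gamma> \<le> c t \<and> c t \<le> \<gamma> + lam / t0\<^sup>2" if "t > t0" for t
    using that assms(1,2) by (auto simp: c_def intro!: divide_left_mono power_mono)
  obtain A w where "A > 0" and
    E_deriv: "\<And>t. t > t0 \<Longrightarrow> ((\<lambda>t. A * (g (x t) + lam / 2 * (norm (v t))\<^sup>2) + g (x t + v t))
      has_real_derivative w t) (at t)" and
    w: "\<And>t. t > t0 \<Longrightarrow> w t \<le> - (1 / (2 * lam)) * t * ((norm (?G (x t)))\<^sup>2 + (norm (v t))\<^sup>2)"
    using lyapunov_function[OF g lip assms(1,2,3) c x_deriv v_deriv] by blast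
  \<comment> \<open>Subtracting \<open>(A + 1) * g xbar\<close> normalises the limit to zero, since
    both \<open>x\<close> and \<open>x + v\<close> tend to \<open>xbar\<close>.\<close>
  define W where
    "W t = A * (g (x t) + lam / 2 * (norm (v t))\<^sup>2) + g (x t + v t) - (A + 1) * g xbar" for t
  define d where "d t = sqrt ((norm (?G (x t)))\<^sup>2 + (norm (v t))\<^sup>2)" for t
  have G_lim: "((\<lambda>t. ?G (x t)) \<longlongrightarrow> 0) at_top"
    using isCont_tendsto_compose[OF _ assms(10), of ?G] G_cont assms(9)
    by (simp add: crit_def continuous_on_eq_continuous_at)
  have v_lim: "(v \<longlongrightarrow> 0) at_top"
    by (rule damped_velocity_tendsto_0[OF assms(1,2,3) _ v_deriv G_lim]) (use c in auto)
  have "((\<lambda>t. x t + v t) \<longlongrightarrow> xbar) at_top"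
    using tendsto_add[OF assms(10) v_lim] by simp
  then have "(W \<longlongrightarrow> A * (g xbar + lam / 2 * (norm (0 :: real ^ 'n))\<^sup>2) + g xbar - (A + 1) * g xbar) at_top"
    unfolding W_def by (intro tendsto_intros isCont_tendsto_compose[OF g_cont] assms(10) v_lim)
  then have W_lim: "(W \<longlongrightarrow> 0) at_top" by (simp add: algebra_simps)
  obtain K \<epsilon> where "K > 0" "\<epsilon> > 0" and
    loj: "\<And>z. norm (z - xbar) < \<epsilon> \<Longrightarrow> \<bar>g z - g xbar\<bar> powr \<theta> \<le> K * norm (?G z)"
    using assms(11) unfolding lojasiewicz_property_def by blast
  have "((\<lambda>t. (norm (?G (x t)))\<^sup>2 + (norm (v t))\<^sup>2) \<longlongrightarrow> (norm (0 :: real ^ 'n))\<^sup>2 + (norm (0 :: real ^ 'n))\<^sup>2) at_top"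
    by (intro tendsto_intros G_lim v_lim)
  then have "eventually (\<lambda>t. (norm (?G (x t)))\<^sup>2 + (norm (v t))\<^sup>2 < 1) at_top"
    by (rule order_tendstoD) simp
  moreover have "eventually (\<lambda>t. norm (x t - xbar) < \<epsilon>) at_top"
    using tendstoD[OF assms(10) \<open>\<epsilon> > 0\<close>] by (simp add: dist_norm)
  ultimately have "eventually (\<lambda>t. t > t0 \<and> (norm (?G (x t)))\<^sup>2 + (norm (v t))\<^sup>2 < 1
      \<and> norm (x t - xbar) < \<epsilon>) at_top"
    using eventually_gt_at_top[of t0] by eventually_elim auto
  \<comment> \<open>After \<open>t1\<close> the trajectory stays in the ball of the Lojasiewicz
    inequality and \<open>d \<le> 1\<close>, the two conditions for comparing \<open>W\<close> with
    \<open>d\<close>.\<close>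
  then obtain t1 where t1: "\<And>t. t \<ge> t1 \<Longrightarrow> t > t0" "\<And>t. t \<ge> t1 \<Longrightarrow> norm (x t - xbar) < \<epsilon>"
    "\<And>t. t \<ge> t1 \<Longrightarrow> (norm (?G (x t)))\<^sup>2 + (norm (v t))\<^sup>2 \<le> 1"
    unfolding eventually_at_top_linorder by (meson less_imp_le)
  have "t1 > t0" using t1(1) by simp
  then have "t1 > 0" using \<open>t0 > 0\<close> by simp
  define C where "C = ((A + 1) * K powr (1 / \<theta>) + (A * (lam / 2) + 1 + L)) powr \<theta>"
  have "(A + 1) * K powr (1 / \<theta>) + (A * (lam / 2) + 1 + L) > 0"
    using \<open>A > 0\<close> \<open>lam > 0\<close> \<open>L \<ge> 0\<close> by (intro add_nonneg_pos add_pos_nonneg) auto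
  then have "C > 0" by (simp add: C_def)
  have W_deriv: "(W has_real_derivative w t) (at t)" if "t \<ge> t1" for t
    unfolding W_def using DERIV_diff[OF E_deriv[OF t1(1)[OF that]] DERIV_const] by simp
  have w_le: "w t \<le> - (1 / (2 * lam)) * t * (d t)\<^sup>2" if "t \<ge> t1" for t
    using w[OF t1(1)[OF that]] by (simp add: d_def)
  have x'_le: "norm (t *\<^sub>R v t) \<le> t * d t" if "t \<ge> t1" for t
    using that \<open>t1 > 0\<close> by (simp add: d_def)
  have W_le: "\<bar>W t\<bar> powr \<theta> \<le> C * d t" if "t \<ge> t1" for t
    unfolding C_def d_def
  proof (rule lojasiewicz_lyapunov_bound[where r = "\<bar>g (x t) - g xbar\<bar>"])
    \<comment> \<open>Splitting off \<open>g (x t + v t) - g (x t)\<close> means that the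
      Lojasiewicz inequality is applied only at \<open>x t\<close>, never at the shifted
      point.\<close>
    have "W t = (A + 1) * (g (x t) - g xbar) + A * (lam / 2) * (norm (v t))\<^sup>2
        + (g (x t + v t) - g (x t))"
      by (simp add: W_def algebra_simps)
    also have "\<bar>\<dots>\<bar> \<le> \<bar>(A + 1) * (g (x t) - g xbar)\<bar> + \<bar>A * (lam / 2) * (norm (v t))\<^sup>2\<bar>
        + \<bar>g (x t + v t) - g (x t)\<bar>"
      by linarith
    also have "\<dots> \<le> (A + 1) * \<bar>g (x t) - g xbar\<bar> + A * (lam / 2) * (norm (v t))\<^sup>2
        + (norm (?G (x t)) + L * norm (v t)) * norm (v t)"
      using lipschitz_gradient_bound[OF g lip, of "x t" "v t"] \<open>A > 0\<close> \<open>lam > 0\<close>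
      by (simp add: abs_mult)
    finally show "\<bar>W t\<bar> \<le> \<dots>" .
  qed (use \<open>A > 0\<close> \<open>L \<ge> 0\<close> \<open>K > 0\<close> assms(2,12,13) t1[OF that] loj in auto)
  have "1 / (2 * lam) > 0" using \<open>lam > 0\<close> by simp
  note rate = lojasiewicz_rate[OF \<open>t1 > 0\<close> this \<open>C > 0\<close> assms(12,13) W_deriv
      x_deriv[OF t1(1)] w_le x'_le W_le W_lim assms(10)]
  show ?thesis
    using rate \<open>t1 > t0\<close> \<open>t1 > 0\<close> by (meson less_imp_le less_le_trans order_trans)
qed

end
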